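(* Let $G$ and $H$ be connected graphs, let $r\ge 2$, and let $S=\{(u_i,v_i): i\in\{1,\dots,r\}\}$ be a monophonic position set of the Cartesian product $G\,\square\,H$ consisting of $r$ distinct vertices. Then one of the following holds: (a) $S$ lies in a single $G$-layer, or $S$ lies in a single $H$-layer; (b) $u_1,\dots,u_r$ are distinct vertices of $G$ and $v_1,\dots,v_r$ are distinct vertices of $H$, and neither $\{u_1,\dots,u_r\}$ induces a clique in $G$ nor $\{v_1,\dots,v_r\}$ induces a clique in $H$; (c) $\pi_G(S)$ is a clique of $G$ with order at least $2$ and $v_1,\dots,v_r$ are distinct vertices of $H$, or $\pi_H(S)$ is a clique of $H$ with order at least $2$ and $u_1,\dots,u_r$ are distinct vertices of $G$.
   Context: All graphs are finite, simple and undirected. A path in a graph is monophonic (induced) if there are no chords, i.e. no edges between non-consecutive vertices of the path. A set $M$ of vertices of a graph is a monophonic position set if no three distinct vertices of $M$ lie on a common monophonic path. The Cartesian product $G\,\square\,H$ has vertex set $V(G)\times V(H)$, with $(g_1,h_1)$ and $(g_2,h_2)$ adjacent iff ($g_1\sim g_2$ in $G$ and $h_1=h_2$) or ($g_1=g_2$ and $h_1\sim h_2$ in $H$). For $S\subseteq V(G)\times V(H)$, $\pi_G(S)=\{g: (g,h)\in S \text{ for some } h\}$ and $\pi_H(S)=\{h: (g,h)\in S\text{ for some } g\}$. A $G$-layer is a set $V(G)\times\{v\}$ with $v\in V(H)$; an $H$-layer is a set $\{u\}\times V(H)$ with $u\in V(G)$. *)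

theory Defs
  imports "Graph_Theory.Digraph_Component" "Graph_Theory.Vertex_Walk"
begin

text \<open>
  Finite simple undirected graphs are rendered by the locale \<^const>\<open>pair_graph\<close>: finite vertex
  set, no loops, and a symmetric arc relation, so that an undirected edge is a pair of opposite arcs.
\<close>

text \<open>Arcs are symmetric here, so chords need only be excluded in the forward direction.\<close>

definition monophonic_path :: "('a,'b) pre_digraph \<Rightarrow> 'a list \<Rightarrow> bool" where
  "monophonic_path G p \<longleftrightarrow>
     vpath p G \<and> (\<forall>i j. i + 1 < j \<and> j < length p \<longrightarrow> \<not> p ! i \<rightarrow>\<^bsub>G\<^esub> p ! j)"

definition monophonic_position_set :: "('a,'b) pre_digraph \<Rightarrow> 'a set \<Rightarrow> bool" where
  "monophonic_position_set G M \<longleftrightarrow>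
     M \<subseteq> verts G \<and>
     \<not> (\<exists>x\<in>M. \<exists>y\<in>M. \<exists>z\<in>M. x \<noteq> y \<and> x \<noteq> z \<and> y \<noteq> z \<and>
         (\<exists>p. monophonic_path G p \<and> {x, y, z} \<subseteq> set p))"

definition clique :: "('a,'b) pre_digraph \<Rightarrow> 'a set \<Rightarrow> bool" where
  "clique G W \<longleftrightarrow> W \<subseteq> verts G \<and> pairwise (\<lambda>x y. x \<rightarrow>\<^bsub>G\<^esub> y) W"

definition cartesian_product ::
  "'a pair_pre_digraph \<Rightarrow> 'b pair_pre_digraph \<Rightarrow> ('a \<times> 'b) pair_pre_digraph" where
  "cartesian_product G H =
     \<lparr> pverts = pverts G \<times> pverts H,
       parcs = {((g1, h1), (g2, h2)) | g1 h1 g2 h2.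
         (g1, g2) \<in> parcs G \<and> h1 = h2 \<and> h1 \<in> pverts H \<or>
         g1 = g2 \<and> g1 \<in> pverts G \<and> (h1, h2) \<in> parcs H} \<rparr>"

lemma pair_graph_cartesian_product:
  assumes "pair_graph G" "pair_graph H"
  shows "pair_graph (cartesian_product G H)"
proof -
  interpret G: pair_graph G by fact
  interpret H: pair_graph H by fact
  let ?P = "cartesian_product G H"
  have sub: "parcs ?P \<subseteq> pverts ?P \<times> pverts ?P"
    by (auto simp: cartesian_product_def dest: G.arc_fst_in_verts G.arc_snd_in_verts
        H.arc_fst_in_verts H.arc_snd_in_verts)
  have fin: "finite (pverts ?P)"
    using G.pair_finite_verts H.pair_finite_verts by (simp add: cartesian_product_def)
  have "finite (parcs ?P)"
    by (rule finite_subset[OF sub finite_cartesian_product[OF fin fin]])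
  moreover have "symmetric (with_proj ?P)"
    by (auto simp: symmetric_def sym_def cartesian_product_def
        intro: G.arcs_symmetric H.arcs_symmetric)
  moreover have "fst e \<noteq> snd e" if "e \<in> parcs ?P" for e
    using that by (auto simp: cartesian_product_def dest: G.no_loops' H.no_loops')
  ultimately show ?thesis
    using sub fin by unfold_locales auto
qed

text \<open>
  A \<open>G\<close>-layer of the product (\<open>left_layer\<close>) is indexed by a vertex of \<open>H\<close>, and an \<open>H\<close>-layer
  (\<open>right_layer\<close>) by a vertex of \<open>G\<close>.
\<close>

definition left_layer :: "'a pair_pre_digraph \<Rightarrow> 'b \<Rightarrow> ('a \<times> 'b) set" where
  "left_layer G v = pverts G \<times> {v}"

definition right_layer :: "'b pair_pre_digraph \<Rightarrow> 'a \<Rightarrow> ('a \<times> 'b) set" where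
  "right_layer H u = {u} \<times> pverts H"

end

theory Submission
  imports Defs
begin

text \<open>
  If both coordinate maps are injective on \<open>S\<close>, the cases (b) and (c) are exhaustive, and if \<open>S\<close> lies
  in one layer there is nothing to do.  By the symmetry of the two factors, the remaining situation is
  that \<open>S\<close> contains two points \<open>(g, h1)\<close>, \<open>(g, h2)\<close> of one layer and a point outside this layer; here
  \<open>\<pi>\<^sub>G(S)\<close> has to be a clique and the second coordinates have to be distinct
  (lemma \<open>clique_and_inj_of_shared_fst\<close>).

  All the monophonic paths needed to exclude other configurations have one shape (lemma
  \<open>monophonic_path_bent\<close>): they run inside the layer of \<open>g\<close> up to height \<open>h\<close>, cross over at height \<open>h\<close>
  along a monophonic path of \<open>G\<close> from \<open>g\<close> to \<open>g'\<close>, and continue inside the layer of \<open>g'\<close>.  The only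
  possible chords join the two outer pieces.  There are none if \<open>g\<close> and \<open>g'\<close> are not adjacent, and
  none if the outer pieces visit no common height besides \<open>h\<close>.  Choosing the three pieces suitably
  yields the following facts about points of \<open>S\<close>.

  \<^item> With an empty third piece: if \<open>(g, h1)\<close> and \<open>(g, h2)\<close> are in \<open>S\<close>, then \<open>(g', h2)\<close> is not.
  \<^item> With \<open>g\<close>, \<open>g'\<close> not adjacent: the path visits \<open>(g, h1)\<close>, \<open>(g, h2)\<close> and any prescribed point over
    \<open>g'\<close>.  Hence all first coordinates other than \<open>g\<close> are neighbours of \<open>g\<close>.
  \<^item> With crossing path \<open>g', g, g''\<close>: the path visits prescribed points over all three vertices.
    Hence two neighbours of \<open>g\<close> among the first coordinates are adjacent.

  The last two give the clique.  If two points \<open>(a, h)\<close>, \<open>(b, h)\<close> agree in the second coordinate, then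
  the same facts with the factors exchanged show that \<open>h\<close>, \<open>h1\<close>, \<open>h2\<close> are pairwise adjacent, and
  \<open>(g, h1), (g, h2), (a, h2), (a, h)\<close> is a monophonic path with three points in \<open>S\<close>.
\<close>

section \<open>Constructing monophonic paths\<close>

lemma monophonic_path_singleton [simp]:
  "monophonic_path G [x] \<longleftrightarrow> x \<in> verts G"
  by (auto simp: monophonic_path_def vpath_def vwalk_def)

text \<open>Peeling off the first vertex replaces the indices of a chord by induction on the list.\<close>

lemma monophonic_path_Cons_Cons [simp]:
  "monophonic_path G (x # y # p) \<longleftrightarrow>
     monophonic_path G (y # p) \<and> x \<in> verts G \<and> x \<rightarrow>\<^bsub>G\<^esub> y \<and> x \<notin> set (y # p) \<and>
     (\<forall>z\<in>set p. \<not> x \<rightarrow>\<^bsub>G\<^esub> z)"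
proof -
  have "(\<forall>i j. i + 1 < j \<and> j < length (x # y # p) \<longrightarrow> \<not> (x # y # p) ! i \<rightarrow>\<^bsub>G\<^esub> (x # y # p) ! j) \<longleftrightarrow>
    (\<forall>i j. i + 1 < j \<and> j < length (y # p) \<longrightarrow> \<not> (y # p) ! i \<rightarrow>\<^bsub>G\<^esub> (y # p) ! j) \<and>
    (\<forall>z\<in>set p. \<not> x \<rightarrow>\<^bsub>G\<^esub> z)" (is "?L \<longleftrightarrow> ?R1 \<and> ?R2")
  proof (intro iffI conjI)
    assume L: ?L
    show ?R1
    proof (intro allI impI)
      fix i j assume "i + 1 < j \<and> j < length (y # p)"
      then show "\<not> (y # p) ! i \<rightarrow>\<^bsub>G\<^esub> (y # p) ! j"
        using L[rule_format, of "Suc i" "Suc j"] by simp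
    qed
    show ?R2
    proof
      fix z assume "z \<in> set p"
      then obtain k where "k < length p" "z = p ! k" by (metis in_set_conv_nth)
      then show "\<not> x \<rightarrow>\<^bsub>G\<^esub> z" using L[rule_format, of 0 "Suc (Suc k)"] by simp
    qed
  next
    assume R: "?R1 \<and> ?R2"
    show ?L
    proof (intro allI impI)
      fix i j assume ij: "i + 1 < j \<and> j < length (x # y # p)"
      obtain k where k: "j = Suc (Suc k)" using ij by (intro that[of "j - 2"]) arith
      show "\<not> (x # y # p) ! i \<rightarrow>\<^bsub>G\<^esub> (x # y # p) ! j"
      proof (cases i)
        case 0
        then show ?thesis using R ij k by simp
      next
        case (Suc i')
        then show ?thesis using conjunct1[OF R, rule_format, of i' "Suc k"] ij k by simp
      qed
    qed
  qed
  then show ?thesis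
    unfolding monophonic_path_def vpath_def vwalk_def by auto
qed

lemma monophonic_path_imp_distinct: "monophonic_path G p \<Longrightarrow> distinct p"
  by (auto simp: monophonic_path_def)

lemma monophonic_path_imp_verts: "monophonic_path G p \<Longrightarrow> set p \<subseteq> verts G"
  by (auto simp: monophonic_path_def)

lemma monophonic_path_imp_nonempty: "monophonic_path G p \<Longrightarrow> p \<noteq> []"
  by (auto simp: monophonic_path_def)

lemma monophonic_path_ConsD: "monophonic_path G (x # p) \<Longrightarrow> p \<noteq> [] \<Longrightarrow> monophonic_path G p"
  by (cases p) auto

lemma monophonic_path_suffix:
  "monophonic_path G (p @ q) \<Longrightarrow> q \<noteq> [] \<Longrightarrow> monophonic_path G q"
  by (induction p) (auto dest: monophonic_path_ConsD)

lemma monophonic_path_glue: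
  assumes "monophonic_path G (p @ [x])" "monophonic_path G (x # q)"
    and "\<And>a b. a \<in> set p \<Longrightarrow> b \<in> set q \<Longrightarrow> a \<noteq> b \<and> \<not> a \<rightarrow>\<^bsub>G\<^esub> b"
  shows "monophonic_path G (p @ x # q)"
  using assms
proof (induction p)
  case (Cons a p)
  have "monophonic_path G (p @ [x])"
    using Cons.prems(1) monophonic_path_ConsD[of G a "p @ [x]"] by simp
  then have rest: "monophonic_path G (p @ x # q)"
    by (rule Cons.IH[OF _ Cons.prems(2)]) (rule Cons.prems(3), simp_all)
  have cross: "a \<notin> set q" "\<forall>z\<in>set q. \<not> a \<rightarrow>\<^bsub>G\<^esub> z"
    using Cons.prems(3)[of a] by auto
  show ?case
  proof (cases p)
    case Nil
    then show ?thesis using Cons.prems(1,2) cross by simp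
  next
    case (Cons b p')
    then show ?thesis using rest cross Cons.prems(1) by auto
  qed
qed simp

lemma monophonic_path_map:
  assumes "monophonic_path G p" "inj_on f (set p)" "f ` set p \<subseteq> verts G'"
    and "\<And>x y. x \<in> set p \<Longrightarrow> y \<in> set p \<Longrightarrow> f x \<rightarrow>\<^bsub>G'\<^esub> f y \<longleftrightarrow> x \<rightarrow>\<^bsub>G\<^esub> y"
  shows "monophonic_path G' (map f p)"
  using assms
proof (induction p rule: induct_list012)
  case 1
  then show ?case by (simp add: monophonic_path_def vpath_def vwalk_def)
next
  case (3 x y p)
  then have "monophonic_path G' (map f (y # p))" by auto
  then show ?case using "3.prems" by auto
qed simp

text \<open>
  A monophonic path from a neighbour \<open>y\<close> of \<open>x\<close> can be rerouted to start at \<open>x\<close>: jump from \<open>x\<close>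
  directly to the last vertex of the path that equals \<open>x\<close> or is a neighbour of \<open>x\<close>.
\<close>

lemma (in wf_digraph) monophonic_path_if_reachable:
  assumes "x \<rightarrow>\<^sup>* y"
  shows "\<exists>p. monophonic_path G p \<and> hd p = x \<and> last p = y"
  using assms
proof (induction rule: converse_reachable_induct)
  case base
  then show ?case by (intro exI[of _ "[y]"]) simp
next
  case (step x w)
  obtain p where p: "monophonic_path G p" "hd p = w" "last p = y"
    using step.IH by blast
  have "\<exists>z\<in>set p. z = x \<or> x \<rightarrow>\<^bsub>G\<^esub> z"
    using p(2) step.hyps(1) monophonic_path_imp_nonempty[OF p(1)] by (metis hd_in_set)
  then obtain ys z zs where split: "p = ys @ z # zs" and z: "z = x \<or> x \<rightarrow>\<^bsub>G\<^esub> z"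
    and zs: "\<forall>b\<in>set zs. \<not> (b = x \<or> x \<rightarrow>\<^bsub>G\<^esub> b)"
    by (rule split_list_last_propE)
  have tail: "monophonic_path G (z # zs)"
    using p(1) monophonic_path_suffix unfolding split by blast
  show ?case
  proof (cases "z = x")
    case True
    then show ?thesis using tail p(3) split by (intro exI[of _ "z # zs"]) simp
  next
    case False
    then show ?thesis using tail p(3) split z zs adj_in_verts(1)[OF step.hyps(1)]
      by (intro exI[of _ "x # z # zs"]) auto
  qed
qed

lemma obtain_monophonic_path:
  assumes "pair_graph G" "connected (with_proj G)" "x \<in> pverts G" "y \<in> pverts G" "x \<noteq> y"
  obtains p where "monophonic_path (with_proj G) (x # p @ [y])"
proof -
  interpret pair_graph G by fact
  have "x \<rightarrow>\<^sup>*\<^bsub>with_proj G\<^esub> y"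
    using assms(2-4) reachable_mk_symmetric_eq[OF sym_arcs]
    by (auto simp: connected_def)
  then obtain p where p: "monophonic_path (with_proj G) p" "hd p = x" "last p = y"
    using monophonic_path_if_reachable by blast
  then have "p = x # butlast (tl p) @ [y]"
    using monophonic_path_imp_nonempty[OF p(1)] assms(5)
    by (metis append_butlast_last_id last_ConsL last_tl list.collapse)
  then show thesis using p(1) that by metis
qed

section \<open>Bent paths in a Cartesian product\<close>

lemma cartesian_product_verts [simp]:
  "pverts (cartesian_product G H) = pverts G \<times> pverts H"
  by (simp add: cartesian_product_def)

lemma cartesian_product_adj_iff:
  "((a, c), (b, d)) \<in> parcs (cartesian_product G H) \<longleftrightarrow>
     (a, b) \<in> parcs G \<and> c = d \<and> c \<in> pverts H \<or> a = b \<and> a \<in> pverts G \<and> (c, d) \<in> parcs H"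
  by (auto simp: cartesian_product_def)

lemma monophonic_path_right_layer:
  assumes "pair_graph G" "g \<in> pverts G" "monophonic_path (with_proj H) p"
  shows "monophonic_path (with_proj (cartesian_product G H)) (map (Pair g) p)"
proof -
  interpret pair_graph G by fact
  show ?thesis
    using assms(2) monophonic_path_imp_verts[OF assms(3)]
    by (intro monophonic_path_map[OF assms(3)])
       (auto simp: inj_on_def cartesian_product_adj_iff dest: no_loops')
qed

lemma monophonic_path_left_layer:
  assumes "pair_graph H" "h \<in> pverts H" "monophonic_path (with_proj G) p"
  shows "monophonic_path (with_proj (cartesian_product G H)) (map (\<lambda>x. (x, h)) p)"
proof -
  interpret pair_graph H by fact
  show ?thesis
    using assms(2) monophonic_path_imp_verts[OF assms(3)]
    by (intro monophonic_path_map[OF assms(3)])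
       (auto simp: inj_on_def cartesian_product_adj_iff dest: no_loops')
qed

text \<open>
  A vertex of \<open>{g} \<times> Q\<close> or \<open>{g'} \<times> R\<close> differs in both coordinates from every vertex of the crossing
  piece except the corner next to it, so no chord meets the crossing piece.  A chord between the two
  outer pieces would join vertices of equal height over adjacent \<open>g\<close>, \<open>g'\<close>, which the hypothesis on
  \<open>Q\<close> and \<open>R\<close> forbids.
\<close>

lemma monophonic_path_bent:
  assumes G: "pair_graph G" and H: "pair_graph H"
    and P: "monophonic_path (with_proj G) (g # P @ [g'])"
    and Q: "monophonic_path (with_proj H) (Q @ [h])"
    and R: "monophonic_path (with_proj H) (h # R)"
    and QR: "(g, g') \<in> parcs G \<Longrightarrow> set Q \<inter> set R = {}"
  shows "monophonic_path (with_proj (cartesian_product G H))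
    (map (Pair g) Q @ (g, h) # map (\<lambda>x. (x, h)) P @ (g', h) # map (Pair g') R)"
    (is "monophonic_path ?GH _")
proof -
  have g: "g \<in> pverts G" "g' \<in> pverts G" and h: "h \<in> pverts H"
    using monophonic_path_imp_verts[OF P] monophonic_path_imp_verts[OF R] by auto
  have dP: "g \<notin> set P" "g' \<notin> set P" "g \<noteq> g'"
    using monophonic_path_imp_distinct[OF P] by auto
  have dQ: "h \<notin> set Q" and dR: "h \<notin> set R"
    using monophonic_path_imp_distinct[OF Q] monophonic_path_imp_distinct[OF R] by auto
  have "monophonic_path ?GH (map (Pair g) Q @ (g, h) # (map (\<lambda>x. (x, h)) P @ [(g', h)]))"
  proof (rule monophonic_path_glue)
    show "monophonic_path ?GH (map (Pair g) Q @ [(g, h)])"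
      using monophonic_path_right_layer[OF G g(1) Q] by simp
    show "monophonic_path ?GH ((g, h) # (map (\<lambda>x. (x, h)) P @ [(g', h)]))"
      using monophonic_path_left_layer[OF H h P] by simp
  qed (use dP dQ in \<open>auto simp: cartesian_product_adj_iff\<close>)
  then have left: "monophonic_path ?GH
      ((map (Pair g) Q @ (g, h) # map (\<lambda>x. (x, h)) P) @ [(g', h)])"
    by simp
  have "monophonic_path ?GH
      ((map (Pair g) Q @ (g, h) # map (\<lambda>x. (x, h)) P) @ (g', h) # map (Pair g') R)"
  proof (rule monophonic_path_glue[OF left])
    show "monophonic_path ?GH ((g', h) # map (Pair g') R)"
      using monophonic_path_right_layer[OF G g(2) R] by simp
  qed (use dP dR QR in \<open>auto simp: cartesian_product_adj_iff\<close>)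
  then show ?thesis by simp
qed

lemma monophonic_position_set_swap:
  assumes S: "monophonic_position_set (with_proj (cartesian_product G H)) S"
  shows "monophonic_position_set (with_proj (cartesian_product H G)) (prod.swap ` S)"
proof -
  have path: "monophonic_path (with_proj (cartesian_product G H)) (map prod.swap p)"
    if "monophonic_path (with_proj (cartesian_product H G)) p" for p
    using monophonic_path_imp_verts[OF that]
    by (intro monophonic_path_map[OF that]) (auto simp: cartesian_product_adj_iff)
  show ?thesis
    unfolding monophonic_position_set_def
  proof (intro conjI notI)
    show "prod.swap ` S \<subseteq> verts (with_proj (cartesian_product H G))"
      using S by (auto simp: monophonic_position_set_def)
  next
    assume "\<exists>x\<in>prod.swap ` S. \<exists>y\<in>prod.swap ` S. \<exists>z\<in>prod.swap ` S. x \<noteq> y \<and> x \<noteq> z \<and> y \<noteq> z \<and>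
      (\<exists>p. monophonic_path (with_proj (cartesian_product H G)) p \<and> {x, y, z} \<subseteq> set p)"
    then obtain x y z p where xyz: "x \<in> S" "y \<in> S" "z \<in> S" "x \<noteq> y" "x \<noteq> z" "y \<noteq> z"
      and p: "monophonic_path (with_proj (cartesian_product H G)) p"
      and sub: "prod.swap x \<in> set p" "prod.swap y \<in> set p" "prod.swap z \<in> set p"
      by auto
    have "{x, y, z} \<subseteq> set (map prod.swap p)"
      using imageI[OF sub(1), of prod.swap] imageI[OF sub(2), of prod.swap]
        imageI[OF sub(3), of prod.swap] by simp
    then show False
      using S xyz path[OF p] unfolding monophonic_position_set_def by blast
  qed
qed

section \<open>Monophonic position sets with a repeated coordinate\<close>

locale product_position_set = G: pair_graph G + H: pair_graph H
  for G :: "'a pair_pre_digraph" and H :: "'b pair_pre_digraph" +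
  fixes S :: "('a \<times> 'b) set"
  assumes conn_G: "connected (with_proj G)" and conn_H: "connected (with_proj H)"
    and position: "monophonic_position_set (with_proj (cartesian_product G H)) S"
begin

lemma swapped: "product_position_set H G (prod.swap ` S)"
  using conn_G conn_H position G.pair_graph_axioms H.pair_graph_axioms
  by (simp add: product_position_set_def product_position_set_axioms_def
      monophonic_position_set_swap)

lemma in_verts: "(g, h) \<in> S \<Longrightarrow> g \<in> pverts G \<and> h \<in> pverts H"
  using position by (auto simp: monophonic_position_set_def)

text \<open>Every exclusion below is an instance of this one, for suitable pieces \<open>P\<close>, \<open>Q\<close> and \<open>R\<close>.\<close>

lemma no_bent_path_through_three:
  assumes "monophonic_path (with_proj G) (g # P @ [g'])"
    and "monophonic_path (with_proj H) (Q @ [h])" "monophonic_path (with_proj H) (h # R)"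
    and "(g, g') \<in> parcs G \<Longrightarrow> set Q \<inter> set R = {}"
    and "x \<in> S" "y \<in> S" "z \<in> S" "x \<noteq> y" "x \<noteq> z" "y \<noteq> z"
    and "{x, y, z} \<subseteq> {g} \<times> set (Q @ [h]) \<union> set P \<times> {h} \<union> {g'} \<times> set (h # R)"
  shows False
proof -
  let ?p = "map (Pair g) Q @ (g, h) # map (\<lambda>x. (x, h)) P @ (g', h) # map (Pair g') R"
  have path: "monophonic_path (with_proj (cartesian_product G H)) ?p"
    by (rule monophonic_path_bent[OF G.pair_graph_axioms H.pair_graph_axioms assms(1-4)])
  have "set ?p = {g} \<times> set (Q @ [h]) \<union> set P \<times> {h} \<union> {g'} \<times> set (h # R)"
    by auto
  then have "{x, y, z} \<subseteq> set ?p" using assms(11) by (simp only:)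
  with path position assms(5-10) show False
    unfolding monophonic_position_set_def by metis
qed

lemma obtain_path_to:
  assumes "h \<in> pverts H" "h' \<in> pverts H"
  obtains Q where "monophonic_path (with_proj H) (Q @ [h'])" "h \<in> set (Q @ [h'])"
proof (cases "h = h'")
  case True
  then show ?thesis using that[of "[]"] assms by simp
next
  case False
  then obtain p where "monophonic_path (with_proj H) (h # p @ [h'])"
    using obtain_monophonic_path[OF H.pair_graph_axioms conn_H assms] by metis
  then show ?thesis using that[of "h # p"] by simp
qed

lemma obtain_path_from:
  assumes "h \<in> pverts H" "h' \<in> pverts H"
  obtains R where "monophonic_path (with_proj H) (h # R)" "h' \<in> set (h # R)"
proof (cases "h = h'")
  case True
  then show ?thesis using that[of "[]"] assms by simp
next
  case False
  then obtain p where "monophonic_path (with_proj H) (h # p @ [h'])"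
    using obtain_monophonic_path[OF H.pair_graph_axioms conn_H assms] by metis
  then show ?thesis using that[of "p @ [h']"] by simp
qed

text \<open>From \<open>(g, h1)\<close> up to the corner \<open>(g, h2)\<close>, then across to \<open>(g', h2)\<close>, where the path ends.\<close>

lemma no_corner:
  assumes "(g, h1) \<in> S" "(g, h2) \<in> S" "h1 \<noteq> h2" "g \<noteq> g'"
  shows "(g', h2) \<notin> S"
proof
  assume S': "(g', h2) \<in> S"
  obtain P where P: "monophonic_path (with_proj G) (g # P @ [g'])"
    using obtain_monophonic_path[OF G.pair_graph_axioms conn_G] in_verts assms S' by metis
  obtain Q where Q: "monophonic_path (with_proj H) (Q @ [h2])" "h1 \<in> set (Q @ [h2])"
    using obtain_path_to in_verts assms by metis
  have R: "monophonic_path (with_proj H) [h2]" using in_verts[OF S'] by simp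
  show False
    by (rule no_bent_path_through_three[OF P Q(1) R _ assms(1,2) S'])
      (use Q(2) assms(3,4) in auto)
qed

text \<open>
  Over nonadjacent \<open>g\<close>, \<open>g'\<close> the outer pieces are unrestricted, so the path can visit \<open>(g, h1)\<close> and
  \<open>(g, h2)\<close>, cross over at height \<open>h2\<close>, and then continue to \<open>(g', h')\<close>.
\<close>

lemma adjacent_to_shared_fst:
  assumes "(g, h1) \<in> S" "(g, h2) \<in> S" "h1 \<noteq> h2" "(g', h') \<in> S" "g \<noteq> g'"
  shows "(g, g') \<in> parcs G"
proof (rule ccontr)
  assume nadj: "(g, g') \<notin> parcs G"
  obtain P where P: "monophonic_path (with_proj G) (g # P @ [g'])"
    using obtain_monophonic_path[OF G.pair_graph_axioms conn_G] in_verts assms by metis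
  obtain Q where Q: "monophonic_path (with_proj H) (Q @ [h2])" "h1 \<in> set (Q @ [h2])"
    using obtain_path_to in_verts assms by metis
  obtain R where R: "monophonic_path (with_proj H) (h2 # R)" "h' \<in> set (h2 # R)"
    using obtain_path_from in_verts assms by metis
  show False
    by (rule no_bent_path_through_three[OF P Q(1) R(1) _ assms(1,2,4)])
      (use nadj Q(2) R(2) assms(3,5) in auto)
qed

text \<open>The crossing piece is the path \<open>g', g, g''\<close>, taken at the height of the point over \<open>g\<close>.\<close>

lemma neighbours_adjacent:
  assumes "(g', h') \<in> S" "(g, h) \<in> S" "(g'', h'') \<in> S"
    and "(g, g') \<in> parcs G" "(g, g'') \<in> parcs G" "g' \<noteq> g''"
  shows "(g', g'') \<in> parcs G"
proof (rule ccontr)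
  assume nadj: "(g', g'') \<notin> parcs G"
  have neq: "g \<noteq> g'" "g \<noteq> g''" using assms(4,5) G.no_loops' by auto
  have "(g', g) \<in> parcs G" using assms(4) G.arcs_symmetric by simp
  then have P: "monophonic_path (with_proj G) (g' # [g] @ [g''])"
    using nadj neq assms in_verts by auto
  obtain Q where Q: "monophonic_path (with_proj H) (Q @ [h])" "h' \<in> set (Q @ [h])"
    using obtain_path_to in_verts assms by metis
  obtain R where R: "monophonic_path (with_proj H) (h # R)" "h'' \<in> set (h # R)"
    using obtain_path_from in_verts assms by metis
  show False
    by (rule no_bent_path_through_three[OF P Q(1) R(1) _ assms(1-3)])
      (use nadj Q(2) R(2) assms(6) neq in auto)
qed

text \<open>The path \<open>(g, h1), (g, h2), (g', h2), (g', h)\<close> has no chord because \<open>h1\<close> and \<open>h\<close> differ.\<close>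

lemma no_staircase:
  assumes "(g, h1) \<in> S" "(g, h2) \<in> S" "(g', h) \<in> S"
    and "(g, g') \<in> parcs G" "(h1, h2) \<in> parcs H" "(h2, h) \<in> parcs H"
  shows "h1 = h"
proof (rule ccontr)
  assume neq: "h1 \<noteq> h"
  have neqs: "g \<noteq> g'" "h1 \<noteq> h2" "h2 \<noteq> h"
    using assms(4-6) G.no_loops' H.no_loops' by auto
  have P: "monophonic_path (with_proj G) (g # [] @ [g'])"
    using assms in_verts neqs by auto
  have Q: "monophonic_path (with_proj H) ([h1] @ [h2])"
    using assms in_verts neqs by auto
  have R: "monophonic_path (with_proj H) (h2 # [h])"
    using assms in_verts neqs by auto
  show False
    by (rule no_bent_path_through_three[OF P Q R _ assms(1-3)])
      (use neq neqs in auto)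
qed

lemma clique_and_inj_of_shared_fst:
  assumes g: "(g, h1) \<in> S" "(g, h2) \<in> S" "h1 \<noteq> h2"
  assumes out: "(g', h') \<in> S" "g' \<noteq> g"
  shows "clique (with_proj G) (fst ` S)" "2 \<le> card (fst ` S)" "inj_on snd S"
proof -
  interpret swapped: product_position_set H G "prod.swap ` S" by (rule swapped)
  have adj: "(g, a) \<in> parcs G" if "(a, c) \<in> S" "a \<noteq> g" for a c
    using adjacent_to_shared_fst[OF g that(1)] that(2) by blast
  have "(a, b) \<in> parcs G" if ac: "(a, c) \<in> S" and bd: "(b, d) \<in> S" and "a \<noteq> b" for a b c d
  proof -
    consider "a = g" | "b = g" | "a \<noteq> g" "b \<noteq> g" by blast
    then show ?thesis
    proof cases
      case 1
      then show ?thesis using adj[OF bd] \<open>a \<noteq> b\<close> by simp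
    next
      case 2
      then show ?thesis using adj[OF ac] \<open>a \<noteq> b\<close> G.arcs_symmetric by simp
    next
      case 3
      then show ?thesis using neighbours_adjacent[OF ac g(1) bd adj adj] ac bd \<open>a \<noteq> b\<close> by blast
    qed
  qed
  then show "clique (with_proj G) (fst ` S)"
    using in_verts by (auto simp: clique_def pairwise_def)
  have "finite (fst ` S)"
    using in_verts by (intro finite_subset[OF _ G.pair_finite_verts]) auto
  moreover have "{g, g'} \<subseteq> fst ` S"
    using g(1) out(1) by force
  ultimately have "card {g, g'} \<le> card (fst ` S)" by (rule card_mono)
  then show "2 \<le> card (fst ` S)" using out(2) by simp
  have "a = b" if ac: "(a, h) \<in> S" and bd: "(b, h) \<in> S" for a b h
  proof (rule ccontr)
    assume "a \<noteq> b"
    \<comment> \<open>A point over \<open>g\<close> at height \<open>h\<close> would form a corner with \<open>(g, h1)\<close> or \<open>(g, h2)\<close>.\<close>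
    have no_corner_at: "(g, h) \<notin> S" if "(c, h) \<in> S" "c \<noteq> g" for c
      using no_corner[OF g(1) _ _ that(2)[symmetric], of h]
        no_corner[OF g(2) _ _ that(2)[symmetric], of h] g(3) that(1) by auto
    then have nS: "(g, h) \<notin> S" using ac bd \<open>a \<noteq> b\<close> by blast
    then have neq: "a \<noteq> g" "h \<noteq> h1" "h \<noteq> h2" using ac g by auto
    have sw: "(h, a) \<in> prod.swap ` S" "(h, b) \<in> prod.swap ` S"
      "(h1, g) \<in> prod.swap ` S" "(h2, g) \<in> prod.swap ` S"
      using ac bd g by force+
    have h1: "(h, h1) \<in> parcs H"
      by (rule swapped.adjacent_to_shared_fst[OF sw(1,2) \<open>a \<noteq> b\<close> sw(3) neq(2)])
    have h2: "(h, h2) \<in> parcs H"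
      by (rule swapped.adjacent_to_shared_fst[OF sw(1,2) \<open>a \<noteq> b\<close> sw(4) neq(3)])
    have "(h1, h2) \<in> parcs H"
      by (rule swapped.neighbours_adjacent[OF sw(3,1,4) h1 h2 g(3)])
    moreover have "(h2, h) \<in> parcs H" using h2 H.arcs_symmetric by simp
    ultimately have "h1 = h"
      using no_staircase[OF g(1,2) ac adj[OF ac neq(1)]] by blast
    then show False using neq(2) by simp
  qed
  then show "inj_on snd S" by (auto simp: inj_on_def)
qed

lemma layer_or_clique_if_shared_fst:
  assumes "\<not> inj_on fst S"
  shows "(\<exists>x\<in>pverts G. S \<subseteq> right_layer H x) \<or>
    clique (with_proj G) (fst ` S) \<and> 2 \<le> card (fst ` S) \<and> inj_on snd S"
proof -
  obtain g h1 h2 where g: "(g, h1) \<in> S" "(g, h2) \<in> S" "h1 \<noteq> h2"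
    using assms unfolding inj_on_def by (metis prod.collapse prod_eqI)
  show ?thesis
  proof (cases "\<forall>(a, c)\<in>S. a = g")
    case True
    then have "S \<subseteq> right_layer H g" using in_verts by (auto simp: right_layer_def)
    then show ?thesis using in_verts g(1) by blast
  next
    case False
    then show ?thesis using clique_and_inj_of_shared_fst[OF g] by blast
  qed
qed

end

theorem lemma3p4:
  fixes G :: "'a pair_pre_digraph" and H :: "'b pair_pre_digraph"
    and r :: nat and u :: "nat \<Rightarrow> 'a" and v :: "nat \<Rightarrow> 'b" and S :: "('a \<times> 'b) set"
  assumes "pair_graph G" and "connected (with_proj G)"
    and "pair_graph H" and "connected (with_proj H)"
    and "r \<ge> 2"
    and "S = (\<lambda>i. (u i, v i)) ` {1..r}"
    and "inj_on (\<lambda>i. (u i, v i)) {1..r}"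
    and "monophonic_position_set (with_proj (cartesian_product G H)) S"
  shows
    "((\<exists>y\<in>pverts H. S \<subseteq> left_layer G y) \<or> (\<exists>x\<in>pverts G. S \<subseteq> right_layer H x)) \<or>
     (inj_on u {1..r} \<and> inj_on v {1..r} \<and>
       \<not> clique (with_proj G) (u ` {1..r}) \<and> \<not> clique (with_proj H) (v ` {1..r})) \<or>
     (clique (with_proj G) (fst ` S) \<and> card (fst ` S) \<ge> 2 \<and> inj_on v {1..r} \<or>
       clique (with_proj H) (snd ` S) \<and> card (snd ` S) \<ge> 2 \<and> inj_on u {1..r})"
proof -
  interpret product_position_set G H S
    using assms by (simp add: product_position_set_def product_position_set_axioms_def)
  interpret swapped: product_position_set H G "prod.swap ` S" by (rule swapped)
  have img: "fst ` S = u ` {1..r}" "snd ` S = v ` {1..r}"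
    by (simp_all add: assms(6) image_image)
  have inj: "inj_on fst S \<longleftrightarrow> inj_on u {1..r}" "inj_on snd S \<longleftrightarrow> inj_on v {1..r}"
    using comp_inj_on_iff[OF assms(7), of fst] comp_inj_on_iff[OF assms(7), of snd]
    by (simp_all add: assms(6) comp_def)
  have fst_swap: "fst ` prod.swap ` S = snd ` S" by (simp add: image_image)
  have swap_inj: "inj_on fst (prod.swap ` S) \<longleftrightarrow> inj_on snd S"
    "inj_on snd (prod.swap ` S) \<longleftrightarrow> inj_on fst S"
    using comp_inj_on_iff[OF inj_swap, of fst S] comp_inj_on_iff[OF inj_swap, of snd S]
    by (simp_all add: comp_def)
  have layer_swap: "prod.swap ` S \<subseteq> right_layer G y \<longleftrightarrow> S \<subseteq> left_layer G y" for y
    by (auto simp: right_layer_def left_layer_def)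
  consider "\<not> inj_on u {1..r}" | "\<not> inj_on v {1..r}" | "inj_on u {1..r}" "inj_on v {1..r}"
    by blast
  then show ?thesis
  proof cases
    case 1
    then show ?thesis using layer_or_clique_if_shared_fst inj by blast
  next
    case 2
    then show ?thesis
      using swapped.layer_or_clique_if_shared_fst
      unfolding swap_inj fst_swap layer_swap inj by blast
  next
    case 3
    then have "card (fst ` S) = r" "card (snd ` S) = r"
      unfolding img by (simp_all add: card_image)
    then show ?thesis using 3 assms(5) img by auto
  qed
qed

end
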